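(* Let $f:\mathbb{R}\to\mathbb{R}$ and $\beta>0$ be such that $f(\beta)\le 0\le f(-\beta)$ and $f$ is twice continuously differentiable and nonconstant on $[-\beta,\beta]$. Set $$\omega_0:=-\frac{1}{\min_{|x|\le\beta}f'(x)}>0,\qquad \omega_1:=-\min_{|x|\le\beta}\,[f''(x)f(x)],$$ $$\delta_0:=\begin{cases}\min\{1,\delta\},&\text{if }\omega_1>0,\\ 1,&\text{if }\omega_1\le0,\end{cases}\qquad\text{where}\quad \delta:=\frac{-1+\sqrt{1+7\omega_0^2\omega_1}}{2\omega_0^2\omega_1}\ \text{ if }\omega_1>0.$$ Suppose that $\|u_0\|_{L^\infty}\le\beta$. Let $\{\boldsymbol U_m\}_{m=0}^M\subset\mathbb{R}^N$ be the numerical solution with $\boldsymbol U_0=(u_0(x_1),\dots,u_0(x_N))^T$ generated by the LRI2 scheme $$\boldsymbol U_{m+1}=e^{\Delta t\boldsymbol A}\boldsymbol U_m+\frac{\Delta t}{2}\Bigl[e^{\Delta t\boldsymbol A}\boldsymbol f(\boldsymbol U_m)+\boldsymbol f(e^{\Delta t\boldsymbol A}\boldsymbol U_m)\Bigr]+\frac{\Delta t^2}{2}e^{\Delta t\boldsymbol A}\frac{\partial\boldsymbol f}{\partial\boldsymbol u}(\boldsymbol U_m)\boldsymbol f(\boldsymbol U_m),\qquad m=0,1,\dots,M-1.$$ If $0<\Delta t\le\delta_0\omega_0$, then $$\|\boldsymbol U_m\|_\infty\le\beta,\qquad m=0,1,\dots,M.$$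
   Context: Setting (space discretization by central finite differences, homogeneous Neumann boundary conditions, of $\partial_t u=\varepsilon^2\Delta u+f(u)$ on $\Omega$ with initial datum $u_0:\overline\Omega\to\mathbb{R}$): $d\in\{1,2,3\}$, $\Omega\subset\mathbb{R}^d$ is an open bounded interval ($d=1$), rectangle ($d=2$) or rectangular parallelepiped ($d=3$), $\varepsilon>0$. A uniform grid with mesh size $h>0$ in every direction is used, with $n_k\ge2$ grid points (boundary points included) in direction $k$, $N=n_1\cdots n_d$, and grid points $x_1,\dots,x_N\in\overline\Omega$ (first coordinate varying fastest). For $n\ge 2$ let $\boldsymbol\lambda_h^{(n)}$ be $\frac1{h^2}$ times the $n\times n$ tridiagonal matrix with all diagonal entries $-2$, first row $(-2,2,0,\dots,0)$, last row $(0,\dots,0,2,-2)$, and every interior row having entries $1,-2,1$ in the sub-, main and superdiagonal positions. Set $\boldsymbol D_h=\boldsymbol\lambda_h^{(n_1)}$ if $d=1$; $\boldsymbol D_h=\boldsymbol I\otimes\boldsymbol\lambda_h^{(n_1)}+\boldsymbol\lambda_h^{(n_2)}\otimes\boldsymbol I$ if $d=2$; $\boldsymbol D_h=\boldsymbol I\otimes\boldsymbol I\otimes\boldsymbol\lambda_h^{(n_1)}+\boldsymbol I\otimes\boldsymbol\lambda_h^{(n_2)}\otimes\boldsymbol I+\boldsymbol\lambda_h^{(n_3)}\otimes\boldsymbol I\otimes\boldsymbol I$ if $d=3$ ($\otimes$ is the Kronecker product, $\boldsymbol I$ identity matrices of the appropriate sizes), and $\boldsymbol A=\varepsilon^2\boldsymbol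 D_h\in\mathbb{R}^{N\times N}$. Time grid: $T>0$ is fixed, $M$ is a positive integer, $\Delta t=T/M$, $t_m=m\Delta t$. Notation: $\boldsymbol f(\boldsymbol v)=(f(v_1),\dots,f(v_N))^T$ and $\frac{\partial\boldsymbol f}{\partial\boldsymbol u}(\boldsymbol v)=\mathrm{diag}(f'(v_1),\dots,f'(v_N))$ for $\boldsymbol v\in\mathbb{R}^N$; $\|\cdot\|_\infty$ is the maximum norm on $\mathbb{R}^N$; $\|u_0\|_{L^\infty}=\max_{x\in\overline\Omega}|u_0(x)|$. *)

theory Defs
  imports
    Complex_Main
    "HOL-Library.Extended_Real"
    "Jordan_Normal_Form.Matrix"
begin

(* Row i div dim_row B is the row of A: in kron A B the index of B varies fastest. *)
definition kron :: "real mat \<Rightarrow> real mat \<Rightarrow> real mat" where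
  "kron A B = mat (dim_row A * dim_row B) (dim_col A * dim_col B)
     (\<lambda>(i, j). A $$ (i div dim_row B, j div dim_col B) * B $$ (i mod dim_row B, j mod dim_col B))"

(* The exponential series, summed entrywise. It is meant for square matrices, for which every
   entry of the series converges. *)
definition mat_exp :: "real mat \<Rightarrow> real mat" where
  "mat_exp A = mat (dim_row A) (dim_row A) (\<lambda>(i, j). \<Sum>k. (A ^\<^sub>m k) $$ (i, j) / fact k)"

(* The maximum ranges over a nonempty set only if dim_vec v > 0. *)
definition max_norm :: "real vec \<Rightarrow> real" where
  "max_norm v = (MAX i\<in>{..<dim_vec v}. \<bar>v $ i\<bar>)"

(* Valued in the extended reals, so that the norm of an unbounded function is infinite rather
   than an unspecified real number. *)
definition sup_norm_on :: "'a set \<Rightarrow> ('a \<Rightarrow> real) \<Rightarrow> ereal" where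
  "sup_norm_on S u = (SUP x\<in>S. ereal \<bar>u x\<bar>)"

(* The closure of the open box with opposite corners a and b, when a $ k < b $ k for all k. *)
definition closed_box :: "real vec \<Rightarrow> real vec \<Rightarrow> real vec set" where
  "closed_box a b =
     {x \<in> carrier_vec (dim_vec a). \<forall>k<dim_vec a. a $ k \<le> x $ k \<and> x $ k \<le> b $ k}"

definition second_difference :: "real \<Rightarrow> nat \<Rightarrow> real mat" where
  "second_difference h n = (1 / h\<^sup>2) \<cdot>\<^sub>m mat n n (\<lambda>(i, j).
     if i = j then -2
     else if (i = 0 \<and> j = 1) \<or> (i = n - 1 \<and> j = n - 2) then 2
     else if i = j + 1 \<or> j = i + 1 then 1
     else 0)"

(* The list contains the numbers of grid points in the coordinate directions. Its length is the
   space dimension; lists of any other length than 1, 2, 3 are left unspecified. *)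
fun neumann_laplacian :: "real \<Rightarrow> nat list \<Rightarrow> real mat" where
  "neumann_laplacian h [n1] = second_difference h n1"
| "neumann_laplacian h [n1, n2] =
     kron (1\<^sub>m n2) (second_difference h n1) + kron (second_difference h n2) (1\<^sub>m n1)"
| "neumann_laplacian h [n1, n2, n3] =
     kron (kron (1\<^sub>m n3) (1\<^sub>m n2)) (second_difference h n1)
     + kron (kron (1\<^sub>m n3) (second_difference h n2)) (1\<^sub>m n1)
     + kron (kron (second_difference h n3) (1\<^sub>m n2)) (1\<^sub>m n1)"

(* Point number i < prod_list ns of the uniform grid with corner a and mesh size h. Its k-th
   coordinate index is the k-th digit of i in the mixed radix system with digits below ns ! k,
   least significant first: the first coordinate varies fastest. *)
definition grid_point :: "real vec \<Rightarrow> real \<Rightarrow> nat list \<Rightarrow> nat \<Rightarrow> real vec" where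
  "grid_point a h ns i =
     vec (length ns) (\<lambda>k. a $ k + real (i div prod_list (take k ns) mod ns ! k) * h)"

definition grid_values :: "real vec \<Rightarrow> real \<Rightarrow> nat list \<Rightarrow> (real vec \<Rightarrow> real) \<Rightarrow> real vec" where
  "grid_values a h ns u = vec (prod_list ns) (\<lambda>i. u (grid_point a h ns i))"

definition jacobian :: "(real \<Rightarrow> real) \<Rightarrow> real vec \<Rightarrow> real mat" where
  "jacobian f' v = mat_diag (dim_vec v) (\<lambda>i. f' (v $ i))"

definition lri2_step ::
  "(real \<Rightarrow> real) \<Rightarrow> (real \<Rightarrow> real) \<Rightarrow> real \<Rightarrow> real mat \<Rightarrow> real vec \<Rightarrow> real vec" where
  "lri2_step f f' dt A U =
     mat_exp (dt \<cdot>\<^sub>m A) *\<^sub>v U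
     + (dt / 2) \<cdot>\<^sub>v (mat_exp (dt \<cdot>\<^sub>m A) *\<^sub>v map_vec f U + map_vec f (mat_exp (dt \<cdot>\<^sub>m A) *\<^sub>v U))
     + (dt\<^sup>2 / 2) \<cdot>\<^sub>v (mat_exp (dt \<cdot>\<^sub>m A) *\<^sub>v (jacobian f' U *\<^sub>v map_vec f U))"

(* In omega0 and omega1 the infimum is a minimum whenever f, f' and f'' are continuous on the
   compact interval {-\<beta>..\<beta>}. *)
definition omega0 :: "(real \<Rightarrow> real) \<Rightarrow> real \<Rightarrow> real" where
  "omega0 f' \<beta> = - 1 / (INF x\<in>{-\<beta>..\<beta>}. f' x)"

definition omega1 :: "(real \<Rightarrow> real) \<Rightarrow> (real \<Rightarrow> real) \<Rightarrow> real \<Rightarrow> real" where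
  "omega1 f f'' \<beta> = - (INF x\<in>{-\<beta>..\<beta>}. f'' x * f x)"

definition delta :: "real \<Rightarrow> real \<Rightarrow> real" where
  "delta w0 w1 = (- 1 + sqrt (1 + 7 * w0\<^sup>2 * w1)) / (2 * w0\<^sup>2 * w1)"

definition delta0 :: "real \<Rightarrow> real \<Rightarrow> real" where
  "delta0 w0 w1 = (if w1 > 0 then min 1 (delta w0 w1) else 1)"

end

theory Submission
  imports Defs
begin

text \<open>
  The matrix \<open>A\<close> has zero row sums and nonnegative off-diagonal entries, so \<open>E = exp (dt A)\<close> is row
  stochastic and does not increase bounds on the entries. Let \<open>t = dt / \<omega>\<^sub>0 \<le> 1\<close>. The weight of the
  linear term \<open>E U\<close> is split as \<open>(1 - t/2) + t/2\<close>, so that one step reads \<open>E p(U) + q(E U)\<close> with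
  \<open>p(x) = (1 - t/2) x + dt/2 f(x) + dt\<^sup>2/2 f'(x) f(x)\<close> and \<open>q(x) = t/2 x + dt/2 f(x)\<close>.
  With \<open>y = dt f'(x) \<ge> -t\<close>, the map \<open>q\<close> is nondecreasing, and
  \<open>2 p'(x) \<ge> 2 - t + y + y\<^sup>2 - dt\<^sup>2 \<omega>\<^sub>1 \<ge> 7/4 - t - dt\<^sup>2 \<omega>\<^sub>1\<close>, which is nonnegative under the
  restriction encoded in \<open>\<delta>\<^sub>0\<close>. The signs of \<open>f\<close> at the endpoints then give
  \<open>\<bar>p\<bar> \<le> (1 - t/2) \<beta>\<close> and \<open>\<bar>q\<bar> \<le> t/2 \<beta>\<close> on \<open>[-\<beta>, \<beta>]\<close>.
\<close>

section \<open>Row sums and signs of matrix products and powers\<close>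

definition row_sums :: "nat \<Rightarrow> real \<Rightarrow> real mat \<Rightarrow> bool" where
  "row_sums n s A \<longleftrightarrow> A \<in> carrier_mat n n \<and> (\<forall>i<n. (\<Sum>j<n. A $$ (i, j)) = s)"

definition nonneg_mat :: "nat \<Rightarrow> real mat \<Rightarrow> bool" where
  "nonneg_mat n A \<longleftrightarrow> A \<in> carrier_mat n n \<and> (\<forall>i<n. \<forall>j<n. 0 \<le> A $$ (i, j))"

text \<open>These are the transition rate matrices (generators) of continuous-time Markov chains on
  \<open>n\<close> states.\<close>

definition generator_mat :: "nat \<Rightarrow> real mat \<Rightarrow> bool" where
  "generator_mat n A \<longleftrightarrow> row_sums n 0 A \<and> (\<forall>i<n. \<forall>j<n. i \<noteq> j \<longrightarrow> 0 \<le> A $$ (i, j))"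

lemma mat_mult_entry:
  assumes "A \<in> carrier_mat n n" "B \<in> carrier_mat n n" "i < n" "j < n"
  shows "(A * B) $$ (i, j) = (\<Sum>k<n. A $$ (i, k) * B $$ (k, j))"
  using assms by (auto simp: scalar_prod_def lessThan_atLeast0 intro!: sum.cong)

lemma mult_mat_vec_entry:
  assumes "A \<in> carrier_mat n n" "v \<in> carrier_vec n" "i < n"
  shows "(A *\<^sub>v v) $ i = (\<Sum>j<n. A $$ (i, j) * v $ j)"
  using assms by (auto simp: scalar_prod_def lessThan_atLeast0 intro!: sum.cong)

lemma row_sums_mult:
  assumes A: "row_sums n s A" and B: "row_sums n t B"
  shows "row_sums n (s * t) (A * B)"
proof -
  have cA: "A \<in> carrier_mat n n" and cB: "B \<in> carrier_mat n n"
    using assms by (auto simp: row_sums_def)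
  have "(\<Sum>j<n. (A * B) $$ (i, j)) = s * t" if i: "i < n" for i
  proof -
    have "(\<Sum>j<n. (A * B) $$ (i, j)) = (\<Sum>j<n. \<Sum>k<n. A $$ (i, k) * B $$ (k, j))"
      using mat_mult_entry[OF cA cB i] by simp
    also have "\<dots> = (\<Sum>k<n. A $$ (i, k) * (\<Sum>j<n. B $$ (k, j)))"
      by (subst sum.swap) (simp add: sum_distrib_left)
    also have "\<dots> = s * t"
      using A B i by (simp add: row_sums_def flip: sum_distrib_right)
    finally show ?thesis .
  qed
  then show ?thesis using cA cB by (auto simp: row_sums_def)
qed

lemma row_sums_one: "row_sums n 1 (1\<^sub>m n)"
  by (auto simp: row_sums_def sum.delta)

lemma row_sums_pow:
  assumes "row_sums n s A"
  shows "row_sums n (s ^ k) (A ^\<^sub>m k)"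
proof (induction k)
  case 0
  have "dim_row A = n" using assms by (auto simp: row_sums_def)
  then show ?case using row_sums_one by simp
next
  case (Suc k)
  then show ?case using row_sums_mult[OF Suc assms] by (simp add: mult.commute)
qed

lemma nonneg_mat_pow:
  assumes A: "nonneg_mat n A"
  shows "nonneg_mat n (A ^\<^sub>m k)"
proof (induction k)
  case 0
  have "dim_row A = n" using A by (auto simp: nonneg_mat_def)
  then show ?case by (auto simp: nonneg_mat_def)
next
  case (Suc k)
  have cA: "A \<in> carrier_mat n n" and cAk: "A ^\<^sub>m k \<in> carrier_mat n n"
    using A by (auto simp: nonneg_mat_def)
  show ?case
    using A Suc cA cAk mat_mult_entry[OF cAk cA]
    by (auto simp: nonneg_mat_def intro!: sum_nonneg)
qed

section \<open>The exponential of a generator is a stochastic matrix\<close>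

lemma pow_mat_Suc_left:
  fixes B :: "real mat"
  assumes "B \<in> carrier_mat n n"
  shows "B ^\<^sub>m Suc l = B * B ^\<^sub>m l"
proof (induction l)
  case (Suc l)
  have "B ^\<^sub>m Suc (Suc l) = (B * B ^\<^sub>m l) * B"
    using Suc by simp
  also have "\<dots> = B * B ^\<^sub>m Suc l"
    using assoc_mult_mat[OF assms pow_carrier_mat[OF assms] assms] by simp
  finally show ?case .
qed (use assms in simp)

text \<open>One increment of \<open>k\<close> acts on sequences in \<open>n\<close> as the shift
  plus \<open>c\<close> times the identity. These two commute, so this is the binomial theorem for
  their sum. It serves to expand the powers of \<open>A = B - c I\<close> entry by entry.\<close>

lemma iterated_shift_binomial:
  fixes x :: "nat \<Rightarrow> nat \<Rightarrow> real"
  assumes step: "\<And>k n. x (Suc k) n = x k (Suc n) + c * x k n"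
  shows "x k n = (\<Sum>l\<le>k. real (k choose l) * c ^ (k - l) * x 0 (n + l))"
proof (induction k arbitrary: n)
  case 0
  then show ?case by simp
next
  case (Suc k)
  \<comment> \<open>Pascal's rule splits every coefficient except the one at
    \<open>l = 0\<close>.\<close>
  have "(\<Sum>l\<le>Suc k. real (Suc k choose l) * c ^ (Suc k - l) * x 0 (n + l))
      = c ^ Suc k * x 0 n + (\<Sum>l\<le>k. real (k choose l) * c ^ (k - l) * x 0 (Suc n + l))
        + (\<Sum>l\<le>k. real (k choose Suc l) * c ^ (k - l) * x 0 (Suc n + l))"
    by (subst sum.atMost_Suc_shift) (simp add: sum.distrib algebra_simps)
  also have "(\<Sum>l\<le>k. real (k choose Suc l) * c ^ (k - l) * x 0 (Suc n + l)) + c ^ Suc k * x 0 n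
      = (\<Sum>l\<le>Suc k. real (k choose l) * c ^ (Suc k - l) * x 0 (n + l))"
    by (subst sum.atMost_Suc_shift) simp
  then have "c ^ Suc k * x 0 n + (\<Sum>l\<le>k. real (k choose l) * c ^ (k - l) * x 0 (Suc n + l))
        + (\<Sum>l\<le>k. real (k choose Suc l) * c ^ (k - l) * x 0 (Suc n + l))
      = (\<Sum>l\<le>k. real (k choose l) * c ^ (k - l) * x 0 (Suc n + l))
        + (\<Sum>l\<le>Suc k. real (k choose l) * c ^ (Suc k - l) * x 0 (n + l))"
    by linarith
  \<comment> \<open>The top term vanishes because \<open>k choose Suc k = 0\<close>; in all others
    \<open>Suc k - l\<close> exceeds \<open>k - l\<close> by one, which releases the factor
    \<open>c\<close>.\<close>
  also have "(\<Sum>l\<le>Suc k. real (k choose l) * c ^ (Suc k - l) * x 0 (n + l))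
      = c * (\<Sum>l\<le>k. real (k choose l) * c ^ (k - l) * x 0 (n + l))"
    by (simp add: sum_distrib_left binomial_eq_0) (auto simp: Suc_diff_le intro!: sum.cong)
  finally show ?case using Suc[of n] Suc[of "Suc n"] step[of k n] by simp
qed

text \<open>With \<open>B = A + c I\<close> nonnegative, \<open>exp A = exp (-c) exp B\<close> entrywise, as a Cauchy product.\<close>

lemma generator_exp_series:
  assumes gen: "generator_mat n A" and i: "i < n" and j: "j < n"
  obtains s where "(\<lambda>k. (A ^\<^sub>m k) $$ (i, j) / fact k) sums s" "0 \<le> s"
proof -
  \<comment> \<open>Any \<open>c\<close> that dominates the moduli of all diagonal entries makes
    \<open>B\<close> nonnegative; their sum is a convenient choice.\<close>
  define c where "c = (\<Sum>i<n. \<bar>A $$ (i, i)\<bar>)"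
  define B where "B = A + c \<cdot>\<^sub>m 1\<^sub>m n"
  have cA: "A \<in> carrier_mat n n" using gen by (auto simp: generator_mat_def row_sums_def)
  have cB: "B \<in> carrier_mat n n" using cA by (auto simp: B_def)
  have c_ge: "\<bar>A $$ (k, k)\<bar> \<le> c" if "k < n" for k
    unfolding c_def using that by (intro member_le_sum) auto
  have "0 \<le> B $$ (k, l)" if "k < n" "l < n" for k l
    using gen that c_ge[of k] cA by (cases "k = l") (auto simp: B_def generator_mat_def)
  then have B_nonneg: "nonneg_mat n B" using cB by (simp add: nonneg_mat_def)
  \<comment> \<open>The rows of \<open>B\<close> inherit the sum \<open>c\<close> from the zero row
    sums of \<open>A\<close>. With nonnegativity this bounds the entries of
    \<open>B ^\<^sub>m l\<close> by \<open>c ^ l\<close>, so the exponential series of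
    \<open>B\<close> is dominated by that of \<open>c\<close>.\<close>
  have "(\<Sum>l<n. B $$ (k, l)) = c" if "k < n" for k
  proof -
    have "(\<Sum>l<n. B $$ (k, l)) = (\<Sum>l<n. A $$ (k, l) + (if k = l then c else 0))"
      using that cA by (intro sum.cong) (auto simp: B_def)
    then show ?thesis
      using gen that by (simp add: sum.distrib generator_mat_def row_sums_def)
  qed
  then have B_rows: "row_sums n c B" using cB by (simp add: row_sums_def)
  have Bpow_nonneg: "0 \<le> (B ^\<^sub>m l) $$ (i, k)" if "k < n" for l k
    using nonneg_mat_pow[OF B_nonneg, of l] i that by (simp add: nonneg_mat_def)
  have Bpow_le: "(B ^\<^sub>m l) $$ (i, j) \<le> c ^ l" for l
  proof -
    have "(B ^\<^sub>m l) $$ (i, j) \<le> (\<Sum>k<n. (B ^\<^sub>m l) $$ (i, k))"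
      using j Bpow_nonneg by (intro member_le_sum) auto
    also have "\<dots> = c ^ l"
      using row_sums_pow[OF B_rows, of l] i by (simp add: row_sums_def)
    finally show ?thesis .
  qed
  define p where "p = (\<lambda>l. (B ^\<^sub>m l) $$ (i, j) / fact l)"
  define q where "q = (\<lambda>l. (- c) ^ l / fact l)"
  have p_nonneg: "0 \<le> p l" for l using Bpow_nonneg[OF j] by (simp add: p_def)
  have summable_p: "summable p"
  proof (rule summable_comparison_test')
    show "summable (\<lambda>l. c ^ l / fact l)"
      using summable_exp[of c] by (simp add: field_simps)
    show "norm (p l) \<le> c ^ l / fact l" if "0 \<le> l" for l
      using Bpow_le[of l] Bpow_nonneg[OF j, of l] by (simp add: p_def divide_right_mono)
  qed
  have q_sums: "q sums exp (- c)"
    using exp_converges[of "- c"] by (simp add: q_def divide_inverse mult.commute)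
  have "summable (\<lambda>l. norm (q l))"
    using summable_norm_exp[of "- c"] by (simp add: q_def divide_inverse mult.commute)
  then have "(\<lambda>k. \<Sum>l\<le>k. p l * q (k - l)) sums (suminf p * suminf q)"
    using summable_p p_nonneg by (intro Cauchy_product_sums) auto
  moreover have "(\<Sum>l\<le>k. p l * q (k - l)) = (A ^\<^sub>m k) $$ (i, j) / fact k" for k
  proof -
    \<comment> \<open>On the mixed powers, \<open>A = B - c I\<close> becomes the shift recursion in
      \<open>k\<close> and \<open>l\<close>. Its solution at \<open>l = 0\<close> expands
      \<open>A ^\<^sub>m k\<close> binomially, and division by \<open>fact k\<close> turns the
      binomial coefficients into those of the Cauchy product.\<close>
    define x where "x = (\<lambda>k l. (A ^\<^sub>m k * B ^\<^sub>m l) $$ (i, j))"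
    have "x (Suc k) l = x k (Suc l) + (- c) * x k l" for k l
    proof -
      have cAk: "A ^\<^sub>m k \<in> carrier_mat n n" and cBl: "B ^\<^sub>m l \<in> carrier_mat n n"
        using cA cB by auto
      \<comment> \<open>The new factor \<open>B\<close> has to stand next to
        \<open>A ^\<^sub>m k\<close>, where it is replaced by \<open>A + c I\<close>; the recursion
        for powers puts it at the right end.\<close>
      have comm: "B ^\<^sub>m Suc l = B * B ^\<^sub>m l"
        using cB by (rule pow_mat_Suc_left)
      have "A ^\<^sub>m k * B ^\<^sub>m Suc l = A ^\<^sub>m k * (A * B ^\<^sub>m l + c \<cdot>\<^sub>m B ^\<^sub>m l)"
        unfolding comm using cA cBl
        by (subst B_def) (auto simp: add_mult_distrib_mat[of _ n n] mult_smult_assoc_mat[of _ n n])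
      also have "\<dots> = A ^\<^sub>m Suc k * B ^\<^sub>m l + c \<cdot>\<^sub>m (A ^\<^sub>m k * B ^\<^sub>m l)"
        using cA cAk cBl
        by (simp add: mult_add_distrib_mat[OF cAk mult_carrier_mat[OF cA cBl] smult_carrier_mat[OF cBl]]
            mult_smult_distrib[OF cAk cBl] assoc_mult_mat[OF cAk cA cBl])
      finally have "x k (Suc l) = (A ^\<^sub>m Suc k * B ^\<^sub>m l + c \<cdot>\<^sub>m (A ^\<^sub>m k * B ^\<^sub>m l)) $$ (i, j)"
        by (simp only: x_def)
      also have "\<dots> = x (Suc k) l + c * x k l"
        using carrier_matD[OF mult_carrier_mat[OF cAk cBl]] i j
        by (simp add: x_def del: index_mult_mat)
      finally show ?thesis by simp
    qed
    from iterated_shift_binomial[of x "- c", OF this, of k 0]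
    have "(A ^\<^sub>m k) $$ (i, j) = (\<Sum>l\<le>k. real (k choose l) * (- c) ^ (k - l) * (B ^\<^sub>m l) $$ (i, j))"
      using cA cB by (simp add: x_def)
    then show ?thesis
      by (auto simp: p_def q_def sum_divide_distrib binomial_fact field_simps intro!: sum.cong)
  qed
  ultimately have "(\<lambda>k. (A ^\<^sub>m k) $$ (i, j) / fact k) sums (suminf p * exp (- c))"
    using q_sums sums_unique by force
  then show thesis
    using that suminf_nonneg[OF summable_p] p_nonneg by simp
qed

text \<open>The rows of \<open>A ^\<^sub>m k\<close> sum to \<open>0 ^ k\<close>, which is 1 for
  \<open>k = 0\<close> and 0 otherwise, so only the identity term contributes to the row sums of the
  exponential. The signs come from \<open>generator_exp_series\<close>.\<close>

lemma mat_exp_generator: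
  assumes gen: "generator_mat n A"
  shows "row_sums n 1 (mat_exp A)" and "nonneg_mat n (mat_exp A)"
proof -
  have cA: "A \<in> carrier_mat n n" and rows: "row_sums n 0 A"
    using gen by (auto simp: generator_mat_def row_sums_def)
  have cE: "mat_exp A \<in> carrier_mat n n" using cA by (auto simp: mat_exp_def)
  have entry: "mat_exp A $$ (i, j) = (\<Sum>k. (A ^\<^sub>m k) $$ (i, j) / fact k)" if "i < n" "j < n" for i j
    using that cA by (simp add: mat_exp_def)
  have "(\<Sum>j<n. mat_exp A $$ (i, j)) = 1" if i: "i < n" for i
  proof -
    have "(\<Sum>j<n. mat_exp A $$ (i, j)) = (\<Sum>k. \<Sum>j<n. (A ^\<^sub>m k) $$ (i, j) / fact k)"
    proof (subst suminf_sum)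
      show "summable (\<lambda>k. (A ^\<^sub>m k) $$ (i, j) / fact k)" if "j \<in> {..<n}" for j
        using generator_exp_series[OF gen i, of j] that by (metis lessThan_iff summable_def)
    qed (use i entry in simp)
    also have "\<dots> = (\<Sum>k. 0 ^ k / fact k)"
      using row_sums_pow[OF rows] i by (simp add: row_sums_def flip: sum_divide_distrib)
    also have "\<dots> = exp 0"
      by (simp add: exp_def divide_inverse mult.commute del: exp_zero)
    finally show ?thesis by simp
  qed
  then show "row_sums n 1 (mat_exp A)" using cE by (simp add: row_sums_def)
  have "0 \<le> mat_exp A $$ (i, j)" if "i < n" "j < n" for i j
    using generator_exp_series[OF gen that] entry[OF that] sums_unique by metis
  then show "nonneg_mat n (mat_exp A)" using cE by (simp add: nonneg_mat_def)
qed

text \<open>Each entry of the product is a convex combination of the entries of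
  \<open>v\<close>.\<close>

lemma stochastic_mult_vec_bound:
  assumes "row_sums n 1 E" "nonneg_mat n E" "v \<in> carrier_vec n"
    and v: "\<And>j. j < n \<Longrightarrow> \<bar>v $ j\<bar> \<le> r" and i: "i < n"
  shows "\<bar>(E *\<^sub>v v) $ i\<bar> \<le> r"
proof -
  have "\<bar>(E *\<^sub>v v) $ i\<bar> = \<bar>\<Sum>j<n. E $$ (i, j) * v $ j\<bar>"
    using assms by (subst mult_mat_vec_entry[of _ n]) (auto simp: row_sums_def)
  also have "\<dots> \<le> (\<Sum>j<n. \<bar>E $$ (i, j) * v $ j\<bar>)"
    by (rule sum_abs)
  also have "\<dots> \<le> (\<Sum>j<n. E $$ (i, j) * r)"
    using assms by (intro sum_mono) (auto simp: abs_mult nonneg_mat_def intro!: mult_mono)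
  also have "\<dots> = r"
    using assms by (simp add: row_sums_def flip: sum_distrib_right)
  finally show ?thesis .
qed

section \<open>Kronecker products and the discrete Neumann Laplacian\<close>

lemma row_sums_kron:
  assumes A: "row_sums m s A" and B: "row_sums n t B"
  shows "row_sums (m * n) (s * t) (kron A B)"
proof -
  have cA: "A \<in> carrier_mat m m" and cB: "B \<in> carrier_mat n n"
    using assms by (auto simp: row_sums_def)
  have "(\<Sum>j<m * n. kron A B $$ (i, j)) = s * t" if i: "i < m * n" for i
  proof -
    have n: "n > 0" using i by (cases n) auto
    have i': "i div n < m" "i mod n < n"
      using i n by (auto simp: less_mult_imp_div_less)
    have "(\<Sum>j<m * n. kron A B $$ (i, j))
        = (\<Sum>j<m * n. A $$ (i div n, j div n) * B $$ (i mod n, j mod n))"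
      using i cA cB by (intro sum.cong) (auto simp: kron_def)
    \<comment> \<open>Grouping the columns into \<open>m\<close> blocks of length \<open>n\<close>,
      that is \<open>j = p * n + q\<close>, makes the summand a product of a term in
      \<open>p\<close> and a term in \<open>q\<close>.\<close>
    also have "\<dots> = (\<Sum>p<m. \<Sum>j=p * n..<p * n + n. A $$ (i div n, j div n) * B $$ (i mod n, j mod n))"
      by (rule sum.nat_group[symmetric])
    also have "\<dots> = (\<Sum>p<m. \<Sum>q<n. A $$ (i div n, p) * B $$ (i mod n, q))"
      using n by (subst sum.atLeastLessThan_shift_0) (simp add: lessThan_atLeast0)
    also have "\<dots> = s * t"
      using A B i' by (simp add: row_sums_def flip: sum_distrib_left sum_distrib_right)
    finally show ?thesis .
  qed
  then show ?thesis using cA cB by (auto simp: row_sums_def kron_def)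
qed

text \<open>Off the diagonal, either the block indices differ and the identity contributes a zero,
  or the positions inside the block differ and the entry is an off-diagonal entry of
  \<open>B\<close>.\<close>

lemma generator_kron_one_left:
  assumes B: "generator_mat n B"
  shows "generator_mat (m * n) (kron (1\<^sub>m m) B)"
proof -
  have cB: "B \<in> carrier_mat n n" and rows: "row_sums n 0 B"
    using B by (auto simp: generator_mat_def row_sums_def)
  have "0 \<le> kron (1\<^sub>m m) B $$ (i, j)" if ij: "i < m * n" "j < m * n" "i \<noteq> j" for i j
  proof -
    have n: "n > 0" using ij by (cases n) auto
    have "i mod n \<noteq> j mod n" if "i div n = j div n"
      using that ij(3) by (metis div_mult_mod_eq)
    then show ?thesis
      using B ij n cB by (auto simp: kron_def generator_mat_def less_mult_imp_div_less)
  qed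
  then show ?thesis
    using row_sums_kron[OF row_sums_one[of m] rows] by (simp add: generator_mat_def)
qed

lemma generator_kron_one_right:
  assumes B: "generator_mat m B"
  shows "generator_mat (m * n) (kron B (1\<^sub>m n))"
proof -
  have cB: "B \<in> carrier_mat m m" and rows: "row_sums m 0 B"
    using B by (auto simp: generator_mat_def row_sums_def)
  have "0 \<le> kron B (1\<^sub>m n) $$ (i, j)" if ij: "i < m * n" "j < m * n" "i \<noteq> j" for i j
  proof -
    have n: "n > 0" using ij by (cases n) auto
    have "i div n \<noteq> j div n" if "i mod n = j mod n"
      using that ij(3) by (metis div_mult_mod_eq)
    then show ?thesis
      using B ij n cB by (auto simp: kron_def generator_mat_def less_mult_imp_div_less)
  qed
  then show ?thesis
    using row_sums_kron[OF rows row_sums_one[of n]] by (simp add: generator_mat_def)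
qed

text \<open>This collapses the two identities in the first summand of the three-dimensional
  Laplacian, which then has the form treated by \<open>generator_kron_one_left\<close>.\<close>

lemma kron_one_one: "kron (1\<^sub>m m) (1\<^sub>m n) = 1\<^sub>m (m * n)"
proof (rule eq_matI)
  fix i j assume ij: "i < dim_row (1\<^sub>m (m * n) :: real mat)" "j < dim_col (1\<^sub>m (m * n) :: real mat)"
  have n: "n > 0" using ij by (cases n) auto
  have "i = j" if "i div n = j div n" "i mod n = j mod n"
    using that by (metis div_mult_mod_eq)
  then show "kron (1\<^sub>m m) (1\<^sub>m n) $$ (i, j) = 1\<^sub>m (m * n) $$ (i, j)"
    using ij n by (auto simp: kron_def less_mult_imp_div_less)
qed (auto simp: kron_def)

lemma generator_add:
  assumes "generator_mat n A" "generator_mat n B"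
  shows "generator_mat n (A + B)"
  using assms by (auto simp: generator_mat_def row_sums_def sum.distrib)

lemma generator_smult:
  assumes "generator_mat n A" "0 \<le> c"
  shows "generator_mat n (c \<cdot>\<^sub>m A)"
  using assms by (auto simp: generator_mat_def row_sums_def simp flip: sum_distrib_left)

lemma generator_second_difference:
  assumes n: "n \<ge> 2"
  shows "generator_mat n (second_difference h n)"
proof -
  define g :: "nat \<Rightarrow> nat \<Rightarrow> real" where "g = (\<lambda>i j.
     if i = j then -2
     else if (i = 0 \<and> j = 1) \<or> (i = n - 1 \<and> j = n - 2) then 2
     else if i = j + 1 \<or> j = i + 1 then 1
     else 0)"
  have "(\<Sum>j<n. g i j) = 0" if i: "i < n" for i
  proof -
    \<comment> \<open>The two boundary rows carry a single weight 2 next to the diagonal, interior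
      rows two weights 1. For \<open>n = 2\<close> there are only boundary rows.\<close>
    consider "i = 0" | "i = n - 1" "i > 0" | "0 < i" "i < n - 1" using i by linarith
    then show ?thesis
    proof cases
      case 1
      then have "(\<Sum>j<n. g i j) = (\<Sum>j<n. (if j = 0 then -2 else 0) + (if j = 1 then 2 else 0))"
        using n by (intro sum.cong) (auto simp: g_def)
      then show ?thesis using n by (simp only: sum.distrib) simp
    next
      case 2
      then have "(\<Sum>j<n. g i j) = (\<Sum>j<n. (if j = n - 1 then -2 else 0) + (if j = n - 2 then 2 else 0))"
        using n by (intro sum.cong) (auto simp: g_def)
      then show ?thesis using n by (simp only: sum.distrib) simp
    next
      case 3
      then have "(\<Sum>j<n. g i j) = (\<Sum>j<n. (if j = i then -2 else 0) + (if j = i - 1 then 1 else 0)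
          + (if j = i + 1 then 1 else 0))"
        using n by (intro sum.cong) (auto simp: g_def)
      moreover have "i < n" "i - 1 < n" "i + 1 < n" using 3 by auto
      ultimately show ?thesis by (simp only: sum.distrib) simp
    qed
  qed
  then have "generator_mat n (mat n n (\<lambda>(i, j). g i j))"
    by (auto simp: generator_mat_def row_sums_def) (auto simp: g_def)
  then show ?thesis
    unfolding second_difference_def g_def by (rule generator_smult) simp
qed

lemma generator_neumann_laplacian:
  assumes "length ns \<in> {1, 2, 3}" "\<forall>k<length ns. ns ! k \<ge> 2"
  shows "generator_mat (prod_list ns) (neumann_laplacian h ns)"
proof -
  have ge: "n \<ge> 2" if "n \<in> set ns" for n
    using assms(2) that by (auto simp: in_set_conv_nth)
  from assms(1) consider n1 where "ns = [n1]" | n1 n2 where "ns = [n1, n2]"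
    | n1 n2 n3 where "ns = [n1, n2, n3]"
    by (auto simp: length_Suc_conv numeral_eq_Suc)
  then show ?thesis
  proof cases
    case (1 n1)
    then show ?thesis using ge generator_second_difference by simp
  next
    case (2 n1 n2)
    \<comment> \<open>The first coordinate varies fastest and is therefore the last Kronecker
      factor: sizes multiply in the reverse order of the list.\<close>
    have "generator_mat (n2 * n1) (neumann_laplacian h ns)"
      unfolding 2 neumann_laplacian.simps
      using ge 2 by (intro generator_add generator_kron_one_left generator_kron_one_right
          generator_second_difference) auto
    then show ?thesis by (simp add: 2 mult.commute)
  next
    case (3 n1 n2 n3)
    have "generator_mat (n3 * n2 * n1) (neumann_laplacian h ns)"
      unfolding 3 neumann_laplacian.simps kron_one_one
      using ge 3 by (intro generator_add generator_kron_one_left generator_kron_one_right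
          generator_second_difference) auto
    then show ?thesis by (simp add: 3 mult_ac)
  qed
qed

section \<open>Monotonicity on an interval and the constants of the step restriction\<close>

lemma nondecreasing_on_Icc:
  fixes g g' :: "real \<Rightarrow> real"
  assumes der: "\<And>x. x \<in> {a..b} \<Longrightarrow> (g has_real_derivative g' x) (at x within {a..b})"
    and nonneg: "\<And>x. x \<in> {a..b} \<Longrightarrow> 0 \<le> g' x"
    and xy: "a \<le> x" "x \<le> y" "y \<le> b"
  shows "g x \<le> g y"
proof (rule DERIV_nonneg_imp_increasing_open[OF xy(2)])
  fix z assume z: "x < z" "z < y"
  \<comment> \<open>The derivative within \<open>{a..b}\<close> is one-sided at the endpoints, so
    two-sided derivatives are taken at interior points only and continuity covers the rest.\<close>
  have "at z within {a..b} = at z"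
    using z xy by (intro at_within_Icc_at) auto
  then show "\<exists>D. (g has_real_derivative D) (at z) \<and> 0 \<le> D"
    using der[of z] nonneg[of z] z xy by auto
next
  have "continuous_on {a..b} g"
    using der by (rule DERIV_continuous_on)
  then show "continuous_on {x..y} g"
    by (rule continuous_on_subset) (use xy in auto)
qed

text \<open>Used three times: for \<open>f\<close> itself with \<open>r = 0\<close> in
  \<open>omega0_pos\<close>, and for the two maps into which a step is split.\<close>

lemma bounded_by_endpoints:
  fixes g g' :: "real \<Rightarrow> real"
  assumes der: "\<And>x. x \<in> {-\<beta>..\<beta>} \<Longrightarrow> (g has_real_derivative g' x) (at x within {-\<beta>..\<beta>})"
    and nonneg: "\<And>x. x \<in> {-\<beta>..\<beta>} \<Longrightarrow> 0 \<le> g' x"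
    and "g \<beta> \<le> r" "- r \<le> g (- \<beta>)" and x: "\<bar>x\<bar> \<le> \<beta>"
  shows "\<bar>g x\<bar> \<le> r"
proof -
  have "- \<beta> \<le> x" "x \<le> \<beta>" using x by auto
  then have "g (- \<beta>) \<le> g x" "g x \<le> g \<beta>"
    using nondecreasing_on_Icc[OF der nonneg, of "- \<beta>" x] nondecreasing_on_Icc[OF der nonneg, of x \<beta>]
    by auto
  then show ?thesis using assms(3,4) by linarith
qed

lemma Inf_image_Icc_le:
  fixes g :: "real \<Rightarrow> real"
  assumes "continuous_on {a..b} g" "x \<in> {a..b}"
  shows "(INF x\<in>{a..b}. g x) \<le> g x"
proof -
  obtain y where "y \<in> {a..b}" "\<forall>z\<in>{a..b}. g y \<le> g z"
    using continuous_attains_inf[of "{a..b}" g] assms by auto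
  then have "bdd_below (g ` {a..b})" by (auto intro!: bdd_belowI)
  then show ?thesis using assms(2) by (rule cINF_lower)
qed

text \<open>If \<open>f'\<close> were nonnegative throughout, \<open>f\<close> would increase from a
  nonnegative to a nonpositive value and hence vanish identically, contrary to nonconstancy. So the
  minimum of \<open>f'\<close> is negative.\<close>

lemma omega0_pos:
  fixes f f' :: "real \<Rightarrow> real"
  assumes der: "\<And>x. x \<in> {-\<beta>..\<beta>} \<Longrightarrow> (f has_real_derivative f' x) (at x within {-\<beta>..\<beta>})"
    and cont: "continuous_on {-\<beta>..\<beta>} f'"
    and ends: "f \<beta> \<le> 0" "0 \<le> f (- \<beta>)"
    and nonconst: "\<not> (\<exists>c. \<forall>x\<in>{-\<beta>..\<beta>}. f x = c)"
  shows "0 < omega0 f' \<beta>"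
proof -
  have "\<exists>x\<in>{-\<beta>..\<beta>}. f' x < 0"
  proof (rule ccontr)
    assume "\<not> ?thesis"
    then have "\<And>x. x \<in> {-\<beta>..\<beta>} \<Longrightarrow> 0 \<le> f' x" by force
    from bounded_by_endpoints[OF der this, of 0] ends have "\<forall>x\<in>{-\<beta>..\<beta>}. f x = 0" by force
    with nonconst show False by blast
  qed
  then obtain x where x: "x \<in> {-\<beta>..\<beta>}" "f' x < 0" by blast
  then have "(INF x\<in>{-\<beta>..\<beta>}. f' x) < 0"
    using Inf_image_Icc_le[OF cont x(1)] by linarith
  then show ?thesis by (simp add: omega0_def divide_neg_neg)
qed

text \<open>\<open>\<delta>\<close> is the positive root of \<open>w0\<^sup>2 w1 \<delta>\<^sup>2 + \<delta> = 7/4\<close>.\<close>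

lemma le_delta0_imp:
  assumes "0 \<le> t" "t \<le> delta0 w0 w1"
  shows "t \<le> 1" and "w0\<^sup>2 * w1 * t\<^sup>2 + t \<le> 7 / 4"
proof -
  show t1: "t \<le> 1" using assms by (auto simp: delta0_def split: if_splits)
  show "w0\<^sup>2 * w1 * t\<^sup>2 + t \<le> 7 / 4"
  \<comment> \<open>Here \<open>t \<le> 1\<close> alone suffices; the formula for
    \<open>delta\<close> matters only in the other case, which forces \<open>w1 > 0\<close>.\<close>
  proof (cases "w0\<^sup>2 * w1 \<le> 0")
    case True
    then have "w0\<^sup>2 * w1 * t\<^sup>2 \<le> 0" by (rule mult_nonpos_nonneg) simp
    then show ?thesis using t1 by simp
  next
    case False
    define s where "s = w0\<^sup>2 * w1"
    have s: "s > 0" using False by (simp add: s_def)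
    then have "w1 > 0" by (simp add: s_def zero_less_mult_iff)
    then have "t \<le> (- 1 + sqrt (1 + 7 * s)) / (2 * s)"
      using assms(2) by (simp add: delta0_def delta_def s_def mult_ac)
    then have "2 * s * t + 1 \<le> sqrt (1 + 7 * s)"
      using s by (simp add: field_simps)
    then have "(2 * s * t + 1)\<^sup>2 \<le> (sqrt (1 + 7 * s))\<^sup>2"
      using s assms(1) by (intro power_mono) auto
    \<comment> \<open>Squaring gives \<open>4 s^2 t^2 + 4 s t + 1 \<le> 1 + 7 s\<close>; the ones
      cancel and \<open>4 s\<close> is then divided out.\<close>
    then have "4 * s * (s * t\<^sup>2 + t) \<le> 4 * s * (7 / 4)"
      using s by (simp add: power2_eq_square algebra_simps)
    then have "s * t\<^sup>2 + t \<le> 7 / 4"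
      using s by (simp only: mult_le_cancel_left_pos)
    then show ?thesis by (simp only: s_def)
  qed
qed

section \<open>The maps applied after (outer) and before (inner) the matrix exponential\<close>

lemma outer_part_bound:
  fixes f f' :: "real \<Rightarrow> real"
  assumes der: "\<And>x. x \<in> {-\<beta>..\<beta>} \<Longrightarrow> (f has_real_derivative f' x) (at x within {-\<beta>..\<beta>})"
    and ends: "f \<beta> \<le> 0" "0 \<le> f (- \<beta>)" and dt: "0 \<le> dt"
    and lower: "\<And>x. x \<in> {-\<beta>..\<beta>} \<Longrightarrow> - t \<le> dt * f' x"
    and x: "\<bar>x\<bar> \<le> \<beta>"
  shows "\<bar>t / 2 * x + dt / 2 * f x\<bar> \<le> t / 2 * \<beta>"
proof (rule bounded_by_endpoints[where g = "\<lambda>x. t / 2 * x + dt / 2 * f x"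
      and g' = "\<lambda>x. t / 2 + dt / 2 * f' x", OF _ _ _ _ x])
  show "t / 2 * \<beta> + dt / 2 * f \<beta> \<le> t / 2 * \<beta>"
    using ends dt by (simp add: mult_nonneg_nonpos)
  show "- (t / 2 * \<beta>) \<le> t / 2 * - \<beta> + dt / 2 * f (- \<beta>)"
    using ends dt by simp
qed (use lower in \<open>force intro!: derivative_eq_intros der\<close>)+

lemma inner_part_bound:
  fixes f f' f'' :: "real \<Rightarrow> real"
  assumes der: "\<And>x. x \<in> {-\<beta>..\<beta>} \<Longrightarrow> (f has_real_derivative f' x) (at x within {-\<beta>..\<beta>})"
    and der': "\<And>x. x \<in> {-\<beta>..\<beta>} \<Longrightarrow> (f' has_real_derivative f'' x) (at x within {-\<beta>..\<beta>})"
    and \<beta>: "0 < \<beta>" and ends: "f \<beta> \<le> 0" "0 \<le> f (- \<beta>)" and dt: "0 \<le> dt"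
    and lower: "\<And>x. x \<in> {-\<beta>..\<beta>} \<Longrightarrow> - t \<le> dt * f' x"
    and lower': "\<And>x. x \<in> {-\<beta>..\<beta>} \<Longrightarrow> - w1 \<le> f'' x * f x"
    and t: "t \<le> 1" "dt\<^sup>2 * w1 + t \<le> 7 / 4"
    and x: "\<bar>x\<bar> \<le> \<beta>"
  shows "\<bar>(1 - t / 2) * x + dt / 2 * f x + dt\<^sup>2 / 2 * (f' x * f x)\<bar> \<le> (1 - t / 2) * \<beta>"
proof (rule bounded_by_endpoints[where g = "\<lambda>x. (1 - t / 2) * x + dt / 2 * f x + dt\<^sup>2 / 2 * (f' x * f x)"
      and g' = "\<lambda>x. (1 - t / 2) + dt / 2 * f' x + dt\<^sup>2 / 2 * (f' x * f' x + f'' x * f x)",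
      OF _ _ _ _ x])
  \<comment> \<open>At the endpoints both nonlinear terms are taken together:
    \<open>1 + dt * f' y \<ge> 1 - t \<ge> 0\<close>, so their sum has the sign of
    \<open>f\<close>.\<close>
  have factor: "dt / 2 * f y + dt\<^sup>2 / 2 * (f' y * f y) = dt / 2 * (1 + dt * f' y) * f y" for y
    by (simp add: power2_eq_square algebra_simps)
  have nonneg: "0 \<le> dt / 2 * (1 + dt * f' y)" if "y \<in> {-\<beta>..\<beta>}" for y
    using lower[OF that] t dt by (intro mult_nonneg_nonneg) auto
  show "(1 - t / 2) * \<beta> + dt / 2 * f \<beta> + dt\<^sup>2 / 2 * (f' \<beta> * f \<beta>) \<le> (1 - t / 2) * \<beta>"
    using mult_nonneg_nonpos[OF nonneg[of \<beta>] ends(1)] factor[of \<beta>] \<beta> by force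
  show "- ((1 - t / 2) * \<beta>)
      \<le> (1 - t / 2) * - \<beta> + dt / 2 * f (- \<beta>) + dt\<^sup>2 / 2 * (f' (- \<beta>) * f (- \<beta>))"
    using mult_nonneg_nonneg[OF nonneg[of "- \<beta>"] ends(2)] factor[of "- \<beta>"] \<beta> by force
  fix y assume y: "y \<in> {-\<beta>..\<beta>}"
  show "((\<lambda>x. (1 - t / 2) * x + dt / 2 * f x + dt\<^sup>2 / 2 * (f' x * f x)) has_real_derivative
      (1 - t / 2) + dt / 2 * f' y + dt\<^sup>2 / 2 * (f' y * f' y + f'' y * f y)) (at y within {-\<beta>..\<beta>})"
    by (auto intro!: derivative_eq_intros der[OF y] der'[OF y] simp: algebra_simps)
  have "dt\<^sup>2 * - w1 \<le> dt\<^sup>2 * (f'' y * f y)"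
    using lower'[OF y] by (intro mult_left_mono) auto
  \<comment> \<open>Completing the square in \<open>y + y^2\<close>, with \<open>y\<close> standing
    for \<open>dt * f' y\<close>, costs 1/4; this is how 2 becomes 7/4.\<close>
  moreover have "0 \<le> (dt * f' y + 1 / 2)\<^sup>2" by simp
  ultimately show "0 \<le> (1 - t / 2) + dt / 2 * f' y + dt\<^sup>2 / 2 * (f' y * f' y + f'' y * f y)"
    using t(2) by (simp add: power2_eq_square algebra_simps)
qed

section \<open>One step of the scheme\<close>

lemma lri2_step_bound:
  fixes f f' :: "real \<Rightarrow> real"
  assumes gen: "generator_mat n A" and dt: "0 \<le> dt"
    and U: "U \<in> carrier_vec n" "\<And>i. i < n \<Longrightarrow> \<bar>U $ i\<bar> \<le> \<beta>"
    and inner: "\<And>x. \<bar>x\<bar> \<le> \<beta> \<Longrightarrow>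
      \<bar>(1 - t / 2) * x + dt / 2 * f x + dt\<^sup>2 / 2 * (f' x * f x)\<bar> \<le> (1 - t / 2) * \<beta>"
    and outer: "\<And>x. \<bar>x\<bar> \<le> \<beta> \<Longrightarrow> \<bar>t / 2 * x + dt / 2 * f x\<bar> \<le> t / 2 * \<beta>"
  shows "lri2_step f f' dt A U \<in> carrier_vec n"
    and "i < n \<Longrightarrow> \<bar>lri2_step f f' dt A U $ i\<bar> \<le> \<beta>"
proof -
  define E where "E = mat_exp (dt \<cdot>\<^sub>m A)"
  have rows: "row_sums n 1 E" and nonneg: "nonneg_mat n E"
    using mat_exp_generator[OF generator_smult[OF gen dt]] by (simp_all add: E_def)
  have cE: "E \<in> carrier_mat n n" using rows by (simp add: row_sums_def)
  show "lri2_step f f' dt A U \<in> carrier_vec n"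
    using cE unfolding lri2_step_def E_def[symmetric] by (intro carrier_vecI) simp
  assume i: "i < n"
  define p where "p = vec n (\<lambda>j. (1 - t / 2) * U $ j + dt / 2 * f (U $ j) + dt\<^sup>2 / 2 * (f' (U $ j) * f (U $ j)))"
  define w where "w = (E *\<^sub>v U) $ i"
  have w: "\<bar>w\<bar> \<le> \<beta>"
    unfolding w_def using stochastic_mult_vec_bound[OF rows nonneg U i] .
  have p: "\<bar>(E *\<^sub>v p) $ i\<bar> \<le> (1 - t / 2) * \<beta>"
    by (rule stochastic_mult_vec_bound[OF rows nonneg _ _ i]) (use inner U in \<open>auto simp: p_def simp del: times_divide_eq_left\<close>)
  have jac: "jacobian f' U *\<^sub>v map_vec f U = vec n (\<lambda>j. f' (U $ j) * f (U $ j))"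
  proof (rule eq_vecI)
    fix j assume "j < dim_vec (vec n (\<lambda>j. f' (U $ j) * f (U $ j)))"
    then have j: "j < n" by simp
    have "(jacobian f' U *\<^sub>v map_vec f U) $ j
        = (\<Sum>k<n. jacobian f' U $$ (j, k) * map_vec f U $ k)"
      using U j by (intro mult_mat_vec_entry) (auto simp: jacobian_def)
    also have "\<dots> = (\<Sum>k<n. if k = j then f' (U $ j) * f (U $ j) else 0)"
      using U j by (intro sum.cong) (auto simp: jacobian_def mat_diag_def)
    finally show "(jacobian f' U *\<^sub>v map_vec f U) $ j = vec n (\<lambda>j. f' (U $ j) * f (U $ j)) $ j"
      using j by simp
  qed (use U in \<open>simp add: jacobian_def mat_diag_def\<close>)
  have "lri2_step f f' dt A U $ i = w + dt / 2 * ((E *\<^sub>v map_vec f U) $ i + f w)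
      + dt\<^sup>2 / 2 * (E *\<^sub>v vec n (\<lambda>j. f' (U $ j) * f (U $ j))) $ i"
    unfolding lri2_step_def E_def[symmetric] jac w_def using i cE U by simp
  \<comment> \<open>By linearity of \<open>E\<close>, the share \<open>1 - t / 2\<close> of
    \<open>w\<close> and all terms under the exponential merge into \<open>E p\<close>; the share
    \<open>t / 2\<close> stays with \<open>f w\<close>. The two bounds then add up to
    \<open>\<beta>\<close>.\<close>
  also have "\<dots> = (E *\<^sub>v p) $ i + (t / 2 * w + dt / 2 * f w)"
  proof -
    have "(E *\<^sub>v p) $ i = (\<Sum>j<n. E $$ (i, j) * p $ j)"
      using i cE by (intro mult_mat_vec_entry) (auto simp: p_def)
    also have "\<dots> = (\<Sum>j<n. (1 - t / 2) * (E $$ (i, j) * U $ j) + dt / 2 * (E $$ (i, j) * f (U $ j))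
        + dt\<^sup>2 / 2 * (E $$ (i, j) * (f' (U $ j) * f (U $ j))))"
      by (intro sum.cong) (auto simp: p_def algebra_simps)
    also have "\<dots> = (1 - t / 2) * w + dt / 2 * (E *\<^sub>v map_vec f U) $ i
        + dt\<^sup>2 / 2 * (E *\<^sub>v vec n (\<lambda>j. f' (U $ j) * f (U $ j))) $ i"
      using i cE U
      by (simp add: w_def mult_mat_vec_entry[of _ n] sum.distrib sum_distrib_left del: index_mult_mat_vec)
    finally show ?thesis by (simp add: algebra_simps)
  qed
  finally show "\<bar>lri2_step f f' dt A U $ i\<bar> \<le> \<beta>"
    using p outer[OF w] abs_triangle_ineq[of "(E *\<^sub>v p) $ i" "t / 2 * w + dt / 2 * f w"]
    by (simp add: left_diff_distrib)
qed

section \<open>Initial values on the grid and induction over the time steps\<close>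

lemma grid_point_in_closed_box:
  assumes "0 \<le> h" "dim_vec a = length ns" "\<forall>k<length ns. ns ! k \<ge> 1"
    and "\<forall>k<length ns. b $ k = a $ k + real (ns ! k - 1) * h"
  shows "grid_point a h ns i \<in> closed_box a b"
proof -
  have "real (i div prod_list (take k ns) mod ns ! k) * h \<le> real (ns ! k - 1) * h"
    if "k < length ns" for k
  proof -
    have "i div prod_list (take k ns) mod ns ! k < ns ! k"
      using assms(3) that by (intro mod_less_divisor) force
    then have "i div prod_list (take k ns) mod ns ! k \<le> ns ! k - 1" by linarith
    then show ?thesis using assms(1) by (intro mult_right_mono of_nat_mono)
  qed
  then show ?thesis
    using assms(1,2,4) unfolding closed_box_def grid_point_def by auto
qed

theorem theorem3:
  fixes f f' f'' :: "real \<Rightarrow> real" and \<beta> \<epsilon> h T dt :: real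
    and d M :: nat and ns :: "nat list"
    and a b :: "real vec" and u0 :: "real vec \<Rightarrow> real"
    and A :: "real mat" and U :: "nat \<Rightarrow> real vec"
  assumes "d \<in> {1, 2, 3}" and "\<epsilon> > 0" and "h > 0"
    and "length ns = d" and "\<forall>k<d. ns ! k \<ge> 2"
    and "a \<in> carrier_vec d" and "b \<in> carrier_vec d"
    and "\<forall>k<d. b $ k = a $ k + real (ns ! k - 1) * h"
    and "A = \<epsilon>\<^sup>2 \<cdot>\<^sub>m neumann_laplacian h ns"
    and "T > 0" and "M > 0" and "dt = T / real M"
    and "\<beta> > 0" and "f \<beta> \<le> 0" and "0 \<le> f (- \<beta>)"
    and "\<forall>x\<in>{-\<beta>..\<beta>}. (f has_real_derivative f' x) (at x within {-\<beta>..\<beta>})"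
    and "\<forall>x\<in>{-\<beta>..\<beta>}. (f' has_real_derivative f'' x) (at x within {-\<beta>..\<beta>})"
    and "continuous_on {-\<beta>..\<beta>} f''"
    and "\<not> (\<exists>c. \<forall>x\<in>{-\<beta>..\<beta>}. f x = c)"
    and "sup_norm_on (closed_box a b) u0 \<le> ereal \<beta>"
    and "U 0 = grid_values a h ns u0"
    and "\<forall>m<M. U (m + 1) = lri2_step f f' dt A (U m)"
  shows "0 < omega0 f' \<beta> \<and>
    (0 < dt \<and> dt \<le> delta0 (omega0 f' \<beta>) (omega1 f f'' \<beta>) * omega0 f' \<beta> \<longrightarrow>
      (\<forall>m\<le>M. max_norm (U m) \<le> \<beta>))"
proof -
  define n where "n = prod_list ns"
  define w0 where "w0 = omega0 f' \<beta>"
  define w1 where "w1 = omega1 f f'' \<beta>"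
  have der: "\<And>x. x \<in> {-\<beta>..\<beta>} \<Longrightarrow> (f has_real_derivative f' x) (at x within {-\<beta>..\<beta>})"
    and der': "\<And>x. x \<in> {-\<beta>..\<beta>} \<Longrightarrow> (f' has_real_derivative f'' x) (at x within {-\<beta>..\<beta>})"
    using assms by auto
  have cont: "continuous_on {-\<beta>..\<beta>} f" and cont': "continuous_on {-\<beta>..\<beta>} f'"
    using der der' by (blast intro: DERIV_continuous_on)+
  have w0: "0 < w0"
    unfolding w0_def using omega0_pos[OF der cont' assms(14,15,19)] .
  have lower: "- 1 / w0 \<le> f' x" if "x \<in> {-\<beta>..\<beta>}" for x
    using Inf_image_Icc_le[OF cont' that] by (simp add: w0_def omega0_def)
  have "continuous_on {-\<beta>..\<beta>} (\<lambda>x. f'' x * f x)"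
    using assms(18) cont by (rule continuous_on_mult)
  from Inf_image_Icc_le[OF this]
  have lower': "- w1 \<le> f'' x * f x" if "x \<in> {-\<beta>..\<beta>}" for x
    using that by (simp add: w1_def omega1_def)
  have gen: "generator_mat n A"
    unfolding n_def assms(9) using assms(1,4,5) by (intro generator_smult generator_neumann_laplacian) auto
  \<comment> \<open>The maximum in \<open>max_norm\<close> is then over a nonempty set.\<close>
  have n: "0 < n"
    using assms(4,5) unfolding n_def by (metis gr_zeroI in_set_conv_nth not_numeral_le_zero prod_list_zero_iff)
  have "max_norm (U m) \<le> \<beta>" if dt: "0 < dt" "dt \<le> delta0 w0 w1 * w0" and m: "m \<le> M" for m
  proof -
    \<comment> \<open>With this \<open>t\<close>, the bound \<open>- 1 / w0 \<le> f' x\<close>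
      becomes \<open>- t \<le> dt * f' x\<close>, and the step restriction becomes
      \<open>t \<le> delta0 w0 w1\<close>.\<close>
    define t where "t = dt / w0"
    have "0 \<le> t" "t \<le> delta0 w0 w1"
      using dt w0 by (auto simp: t_def field_simps)
    \<comment> \<open>Here \<open>w0^2 * t^2 = dt^2\<close>.\<close>
    from le_delta0_imp[OF this] have t: "t \<le> 1" "dt\<^sup>2 * w1 + t \<le> 7 / 4"
      using w0 by (auto simp: t_def power_divide mult.commute)
    have lower_t: "- t \<le> dt * f' x" if "x \<in> {-\<beta>..\<beta>}" for x
      using mult_left_mono[OF lower[OF that], of dt] dt by (simp add: t_def)
    \<comment> \<open>The dimension is carried along in the induction because
      \<open>lri2_step_bound\<close> requires it of the current iterate.\<close>
    have "U m \<in> carrier_vec n \<and> (\<forall>i<n. \<bar>U m $ i\<bar> \<le> \<beta>)"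
      using m
    proof (induction m)
      case 0
      have "\<bar>u0 (grid_point a h ns i)\<bar> \<le> \<beta>" for i
      proof -
        have "grid_point a h ns i \<in> closed_box a b"
          using assms(3-6,8) by (intro grid_point_in_closed_box) force+
        then have "ereal \<bar>u0 (grid_point a h ns i)\<bar> \<le> sup_norm_on (closed_box a b) u0"
          unfolding sup_norm_on_def by (rule SUP_upper)
        then have "ereal \<bar>u0 (grid_point a h ns i)\<bar> \<le> ereal \<beta>"
          using assms(20) by (rule order_trans)
        then show ?thesis by simp
      qed
      then show ?case using assms(21) by (simp add: grid_values_def n_def)
    next
      case (Suc m)
      have IH: "U m \<in> carrier_vec n" "\<And>i. i < n \<Longrightarrow> \<bar>U m $ i\<bar> \<le> \<beta>"
        using Suc by auto
      note bounds = lri2_step_bound[OF gen less_imp_le[OF dt(1)] IH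
          inner_part_bound[OF der der' assms(13-15) less_imp_le[OF dt(1)] lower_t lower' t]
          outer_part_bound[OF der assms(14,15) less_imp_le[OF dt(1)] lower_t]]
      have "U (Suc m) = lri2_step f f' dt A (U m)"
        using assms(22) Suc.prems by simp
      then show ?case using bounds by simp
    qed
    then show ?thesis
      using n by (simp add: max_norm_def) (intro Max.boundedI; auto)
  qed
  then show ?thesis using w0 by (simp add: w0_def w1_def)
qed

end
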